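(* Let $a$ be a real number. For any integer $m\geq 0$, there exists a global analytic solution $R(\theta)$ on $[0,\infty)$ to the mirror pantograph equation $$\sin\theta\,R'(\theta)=4a\,R(2\theta)-3\cos\theta\,R(\theta)$$ with $R(\theta)\sim\theta^m$ near $0$, up to a nonzero constant factor, if and only if $a=\frac{m+3}{2^{m+2}}$. This solution is unique up to scale.
   Context: "Analytic on $[0,\infty)$" means real-analytic on $[0,\infty)$, including at the endpoint $0$ (i.e. given by a convergent Taylor series at $0$). The condition "$R(\theta)\sim\theta^m$ near $0$, up to a nonzero constant factor" means that $R(\theta)/\theta^m\to C$ as $\theta\to0^+$ for some real $C\neq0$. "Unique up to scale" means that any two such solutions (for the same $m$ and $a$) are proportional by a constant. The equation is required to hold for all $\theta\in[0,\infty)$. *)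

theory Defs
  imports "HOL-Analysis.Analysis"
begin

text \<open>
  Real-analyticity relative to a set \<open>S\<close>: near each point of \<open>S\<close> the function agrees \<^emph>\<open>on S\<close> with a
  convergent power series. At an endpoint of \<open>S\<close> this is a one-sided condition, so for
  \<open>S = {0..}\<close> the values at negative arguments are irrelevant. At interior points it is
  ordinary real-analyticity.
\<close>

definition real_analytic_on :: "(real \<Rightarrow> real) \<Rightarrow> real set \<Rightarrow> bool" where
  "real_analytic_on f S \<longleftrightarrow>
     (\<forall>x\<in>S. \<exists>F :: real fps. fps_conv_radius F > 0 \<and>
        (\<forall>\<^sub>F y in nhds x. y \<in> S \<longrightarrow> f y = eval_fps F (y - x)))"

text \<open>The derivative at the endpoint \<open>0\<close> is one-sided.\<close>

definition mirror_pantograph :: "real \<Rightarrow> (real \<Rightarrow> real) \<Rightarrow> bool" where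
  "mirror_pantograph a R \<longleftrightarrow>
     (\<forall>\<theta>\<ge>0. \<exists>D. (R has_real_derivative D) (at \<theta> within {0..}) \<and>
        sin \<theta> * D = 4 * a * R (2 * \<theta>) - 3 * cos \<theta> * R \<theta>)"

definition behaves_like_power :: "nat \<Rightarrow> (real \<Rightarrow> real) \<Rightarrow> bool" where
  "behaves_like_power m R \<longleftrightarrow>
     (\<exists>C. C \<noteq> 0 \<and> ((\<lambda>\<theta>. R \<theta> / \<theta> ^ m) \<longlongrightarrow> C) (at_right 0))"

definition global_solution :: "real \<Rightarrow> nat \<Rightarrow> (real \<Rightarrow> real) \<Rightarrow> bool" where
  "global_solution a m R \<longleftrightarrow>
     real_analytic_on R {0..} \<and> mirror_pantograph a R \<and> behaves_like_power m R"

end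

theory Submission
  imports Defs "HOL-Complex_Analysis.Complex_Analysis" "HOL-Real_Asymp.Real_Asymp"
begin

text \<open>
  For a power series \<open>F\<close> of order \<open>k\<close>, the lowest coefficient of the equation forces
  \<open>4 a 2\<^sup>k = k + 3\<close>. This fixes \<open>a\<close> when \<open>k = m\<close>; moreover, for that \<open>a\<close>, no \<open>k > m\<close>
  satisfies it, so the germ at \<open>0\<close> is unique up to scale, and the equation, solved for
  \<open>R (2 \<theta>)\<close>, propagates uniqueness to \<open>[0, \<infinity>)\<close> by doubling.
  Conversely, the coefficient recursion has divisors of exponential growth, so its solution is bounded.
  Hence its radius of convergence \<open>\<rho>\<close> is positive, and since \<open>F (2 X)\<close>, of radius \<open>\<rho> / 2\<close>, is a
  combination of \<open>F\<close> and its derivative with entire coefficients, \<open>\<rho> \<le> \<rho> / 2\<close> and so \<open>\<rho> = \<infinity>\<close>.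
\<close>

section \<open>The equation as an identity between formal power series\<close>

definition fps_double :: "real fps \<Rightarrow> real fps" where
  "fps_double F = Abs_fps (\<lambda>n. 2 ^ n * fps_nth F n)"

text \<open>With all terms on one side, the equation for a germ becomes the vanishing of a formal
  series that is linear in \<open>F\<close>. Its coefficients can be compared without any
  convergence argument.\<close>

definition pantograph_defect :: "real \<Rightarrow> real fps \<Rightarrow> real fps" where
  "pantograph_defect a F =
     fps_sin 1 * fps_deriv F + 3 * (fps_cos 1 * F) - fps_const (4 * a) * fps_double F"

lemma eval_fps_double: "eval_fps (fps_double F) x = eval_fps F (2 * x)"
  by (simp add: eval_fps_def fps_double_def power_mult_distrib mult_ac)

lemma fps_conv_radius_double: "fps_conv_radius (fps_double F) = fps_conv_radius F / 2"
  using conv_radius_mult_power[of "2::real" "fps_nth F"]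
  by (simp add: fps_conv_radius_def fps_double_def)

text \<open>Convergence is required at \<open>2 * x\<close> and not only at \<open>x\<close>,
  because \<open>fps_double F\<close> has half the radius of \<open>F\<close>.\<close>

lemma eval_pantograph_defect:
  assumes "ereal (2 * \<bar>x\<bar>) < fps_conv_radius F"
  shows "eval_fps (pantograph_defect a F) x =
    sin x * eval_fps (fps_deriv F) x + 3 * cos x * eval_fps F x - 4 * a * eval_fps F (2 * x)"
proof -
  have x: "ereal (norm x) < fps_conv_radius F"
    by (rule le_less_trans[OF _ assms]) simp
  have x': "ereal (norm x) < fps_conv_radius (fps_deriv F)"
    using x fps_conv_radius_deriv[of F] by (rule less_le_trans)
  have x2: "ereal (norm x) < fps_conv_radius (fps_double F)"
    using assms unfolding fps_conv_radius_double
    by (cases "fps_conv_radius F") auto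
  have r1: "ereal (norm x) < fps_conv_radius (fps_sin 1 * fps_deriv F)"
    by (rule less_le_trans[OF _ fps_conv_radius_mult]) (use x' in simp)
  have r2: "ereal (norm x) < fps_conv_radius (fps_cos 1 * F)"
    by (rule less_le_trans[OF _ fps_conv_radius_mult]) (use x in simp)
  have r3: "ereal (norm x) < fps_conv_radius (3 * (fps_cos 1 * F))"
    by (rule less_le_trans[OF _ fps_conv_radius_mult]) (use r2 in simp)
  have r4: "ereal (norm x) < fps_conv_radius (fps_const (4 * a) * fps_double F)"
    by (rule less_le_trans[OF _ fps_conv_radius_mult]) (use x2 in simp)
  have r5: "ereal (norm x) < fps_conv_radius (fps_sin 1 * fps_deriv F + 3 * (fps_cos 1 * F))"
    by (rule less_le_trans[OF _ fps_conv_radius_add]) (use r1 r3 in simp)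
  show ?thesis
    unfolding pantograph_defect_def using x x' x2 r1 r2 r3 r4 r5
    by (simp add: eval_fps_diff eval_fps_add eval_fps_mult eval_fps_double)
qed

text \<open>The factor collects the three contributions of coefficient \<open>n\<close>:
  \<open>n\<close> from the linear term of sine, \<open>3\<close> from the constant term of cosine,
  \<open>4 * a * 2 ^ n\<close> from doubling. The remaining sums involve only coefficients of index
  below \<open>n\<close>.\<close>

lemma pantograph_defect_nth:
  "fps_nth (pantograph_defect a F) n = (real n + 3 - 4 * a * 2 ^ n) * fps_nth F n
     + (\<Sum>i=2..n. fps_nth (fps_sin 1) i * (real (n + 1 - i) * fps_nth F (n + 1 - i)))
     + 3 * (\<Sum>i=1..n. fps_nth (fps_cos 1) i * fps_nth F (n - i))"
proof -
  have s1: "fps_nth (fps_sin (1::real)) 1 = 1"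
    by (simp add: fps_sin_def)
  have c0: "fps_nth (fps_cos (1::real)) 0 = 1"
    by (simp add: fps_cos_def)
  have "fps_nth (fps_sin 1 * fps_deriv F) n =
      (\<Sum>i=0..n. fps_nth (fps_sin 1) i * (real (n + 1 - i) * fps_nth F (n + 1 - i)))"
    unfolding fps_mult_nth by (intro sum.cong) (auto simp: Suc_diff_le)
  also have "\<dots> = real n * fps_nth F n
     + (\<Sum>i=2..n. fps_nth (fps_sin 1) i * (real (n + 1 - i) * fps_nth F (n + 1 - i)))"
  \<comment> \<open>Sine has no constant term, so the summand \<open>i = 0\<close> vanishes, and
    \<open>i = 1\<close> supplies the isolated term.\<close>
  proof (cases n)
    case (Suc k)
    then show ?thesis
      using s1 by (simp add: sum.atLeast_Suc_atMost[of 0] sum.atLeast_Suc_atMost[of "Suc 0"] numeral_2_eq_2)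
  qed auto
  finally have s: "fps_nth (fps_sin 1 * fps_deriv F) n = \<dots>" .
  have c: "fps_nth (fps_cos 1 * F) n = fps_nth F n + (\<Sum>i=1..n. fps_nth (fps_cos 1) i * fps_nth F (n - i))"
    unfolding fps_mult_nth using c0 by (simp add: sum.atLeast_Suc_atMost[of 0])
  show ?thesis
    unfolding pantograph_defect_def fps_sub_nth fps_add_nth fps_mult_numeral_left s c
    by (simp add: fps_double_def algebra_simps)
qed

lemma pantograph_defect_nth_leading:
  assumes "\<And>j. j < n \<Longrightarrow> fps_nth F j = 0"
  shows "fps_nth (pantograph_defect a F) n = (real n + 3 - 4 * a * 2 ^ n) * fps_nth F n"
proof -
  have "fps_nth F (n + 1 - i) = 0" if "i \<in> {2..n}" for i
    by (rule assms) (use that in auto)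
  moreover have "fps_nth F (n - i) = 0" if "i \<in> {1..n}" for i
    by (rule assms) (use that in auto)
  ultimately show ?thesis
    unfolding pantograph_defect_nth by (simp only: mult_zero_right sum.neutral_const add_0_right cong: sum.cong)
qed

text \<open>The lowest coefficient of \<open>F\<close> is nonzero, so its factor in the lowest
  coefficient of the equation must vanish.\<close>

lemma pantograph_indicial_equation:
  assumes "pantograph_defect a F = 0" "F \<noteq> 0"
  shows "4 * a * 2 ^ subdegree F = real (subdegree F) + 3"
proof -
  let ?k = "subdegree F"
  have "0 = fps_nth (pantograph_defect a F) ?k"
    using assms(1) by simp
  also have "\<dots> = (real ?k + 3 - 4 * a * 2 ^ ?k) * fps_nth F ?k"
    using nth_less_subdegree_zero by (rule pantograph_defect_nth_leading)
  finally show ?thesis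
    using assms(2) by simp
qed

text \<open>A step from \<open>k\<close> to \<open>k + 1\<close> doubles
  \<open>4 * a * 2 ^ k\<close> but adds only 1 to \<open>k + 3\<close>, and
  \<open>2 * (k + 3) > k + 4\<close>. This excludes indicial exponents above \<open>m\<close> and
  makes the divisors of the recursion positive.\<close>

lemma pantograph_factor_gt:
  assumes "4 * a * 2 ^ m = real m + 3" "m < n"
  shows "real n + 3 < 4 * a * 2 ^ n"
  using assms(2)
proof (induction n rule: less_induct)
  case (less n)
  then obtain k where k: "n = Suc k" by (cases n) auto
  have "real k + 3 \<le> 4 * a * 2 ^ k"
    using less k assms(1) by (cases "k = m") (auto intro: less_imp_le)
  then show ?case
    unfolding k by simp
qed

lemma pantograph_defect_lincomb:
  "pantograph_defect a (F - fps_const c * G) = pantograph_defect a F - fps_const c * pantograph_defect a G"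
proof -
  have "fps_double (F - fps_const c * G) = fps_double F - fps_const c * fps_double G"
    by (rule fps_ext) (simp add: fps_double_def algebra_simps)
  then show ?thesis
    unfolding pantograph_defect_def by (simp only: fps_deriv_sub fps_deriv_mult_const_left) (simp add: algebra_simps)
qed

section \<open>Order of vanishing from the right at 0\<close>

text \<open>Dividing out the lowest power leaves the shifted series, which is continuous at 0 with
  the lowest coefficient as its value.\<close>

lemma tendsto_eval_fps_subdegree:
  fixes F :: "real fps"
  assumes "fps_conv_radius F > 0"
  shows "((\<lambda>x. eval_fps F x / x ^ subdegree F) \<longlongrightarrow> fps_nth F (subdegree F)) (at_right 0)"
proof -
  let ?k = "subdegree F"
  have "continuous (at_right 0) (eval_fps (fps_shift ?k F))"
    using assms by (intro continuous_eval_fps) (simp flip: zero_ereal_def)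
  then have lim: "(eval_fps (fps_shift ?k F) \<longlongrightarrow> fps_nth F ?k) (at_right 0)"
    by (simp add: continuous_within eval_fps_at_0)
  obtain r where r: "0 < ereal r" "ereal r < fps_conv_radius F"
    using ereal_dense2[OF assms] by auto
  have "eventually (\<lambda>x. x \<in> {0<..<r}) (at_right (0::real))"
    using r(1) by (intro eventually_at_right_real) simp
  then have "eventually (\<lambda>x. eval_fps (fps_shift ?k F) x = eval_fps F x / x ^ ?k) (at_right 0)"
  proof eventually_elim
    case (elim x)
    then have "ereal (norm x) < fps_conv_radius F"
      by (intro less_trans[OF _ r(2)]) simp
    with elim show ?case
      by (subst eval_fps_shift) auto
  qed
  with lim show ?thesis
    by (rule Lim_transform_eventually)
qed

text \<open>The lowest coefficient is a limit from the right, so vanishing on that side alone makes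
  it 0. One side is all that the equation on \<open>{0..}\<close> provides.\<close>

lemma fps_eq_0_if_zero_at_right:
  fixes F :: "real fps"
  assumes "fps_conv_radius F > 0" "eventually (\<lambda>x. eval_fps F x = 0) (at_right 0)"
  shows "F = 0"
proof -
  have "eventually (\<lambda>x. eval_fps F x / x ^ subdegree F = 0) (at_right 0)"
    using assms(2) by eventually_elim simp
  then have "((\<lambda>x. eval_fps F x / x ^ subdegree F) \<longlongrightarrow> 0) (at_right 0)"
    by (rule tendsto_eventually)
  from tendsto_unique[OF _ tendsto_eval_fps_subdegree[OF assms(1)] this]
  show ?thesis by simp
qed

lemma power_order_zero:
  fixes f :: "real \<Rightarrow> real"
  assumes "((\<lambda>x. f x / x ^ m) \<longlongrightarrow> C) (at_right 0)" "((\<lambda>x. f x / x ^ k) \<longlongrightarrow> L) (at_right 0)" "k < m"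
  shows "L = 0"
proof -
  have "((\<lambda>x. x ^ (m - k)) \<longlongrightarrow> 0 ^ (m - k)) (at_right (0::real))"
    by (intro tendsto_intros)
  then have "((\<lambda>x. f x / x ^ m * x ^ (m - k)) \<longlongrightarrow> C * 0 ^ (m - k)) (at_right 0)"
    using assms(1) by (intro tendsto_mult)
  then have lim0: "((\<lambda>x. f x / x ^ m * x ^ (m - k)) \<longlongrightarrow> 0) (at_right 0)"
    using \<open>k < m\<close> by (simp add: power_0_left)
  \<comment> \<open>For positive \<open>x\<close> the quotient by the smaller power is the one by
    \<open>x ^ m\<close> times a positive power of \<open>x\<close>, which tends to 0.\<close>
  have "eventually (\<lambda>x. f x / x ^ m * x ^ (m - k) = f x / x ^ k) (at_right 0)"
    using eventually_at_right_less[of "0::real"]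
  proof eventually_elim
    case (elim x)
    then show ?case
      using \<open>k < m\<close> by (simp add: power_diff field_simps)
  qed
  with lim0 have "((\<lambda>x. f x / x ^ k) \<longlongrightarrow> 0) (at_right 0)"
    by (rule Lim_transform_eventually)
  from tendsto_unique[OF _ assms(2) this] show ?thesis by simp
qed

lemma power_order_unique:
  fixes f :: "real \<Rightarrow> real"
  assumes "((\<lambda>x. f x / x ^ m) \<longlongrightarrow> C) (at_right 0)" "C \<noteq> 0"
    "((\<lambda>x. f x / x ^ k) \<longlongrightarrow> L) (at_right 0)" "L \<noteq> 0"
  shows "k = m"
  using power_order_zero[OF assms(1,3)] power_order_zero[OF assms(3,1)] assms(2,4)
  by (cases k m rule: linorder_cases) auto

section \<open>The germ of a global solution at 0\<close>

lemma mirror_pantographE: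
  assumes "mirror_pantograph a R" "x \<ge> 0"
  obtains D where "(R has_real_derivative D) (at x within {0..})"
    "sin x * D = 4 * a * R (2 * x) - 3 * cos x * R x"
proof -
  have "\<exists>D. (R has_real_derivative D) (at x within {0..}) \<and>
      sin x * D = 4 * a * R (2 * x) - 3 * cos x * R x"
    using assms unfolding mirror_pantograph_def by simp
  then show thesis
    using that by (elim exE conjE)
qed

text \<open>\<open>F\<close> is the expansion of \<open>R\<close> at 0. The growth condition fixes
  its subdegree, and the equation at small positive arguments makes the sum of
  \<open>pantograph_defect a F\<close> vanish there, hence the series itself.\<close>

lemma global_solution_germ:
  assumes "global_solution a m R"
  obtains F d where "F \<noteq> 0" "subdegree F = m" "pantograph_defect a F = 0"
    "d > 0" "ereal d \<le> fps_conv_radius F" "\<And>y. 0 \<le> y \<Longrightarrow> y < d \<Longrightarrow> R y = eval_fps F y"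
proof -
  have an: "real_analytic_on R {0..}" and mp: "mirror_pantograph a R"
    using assms by (auto simp: global_solution_def)
  obtain C where C: "C \<noteq> 0" "((\<lambda>\<theta>. R \<theta> / \<theta> ^ m) \<longlongrightarrow> C) (at_right 0)"
    using assms by (auto simp: global_solution_def behaves_like_power_def)
  obtain F where rad: "fps_conv_radius F > 0"
    and ev: "\<forall>\<^sub>F y in nhds 0. y \<in> {0..} \<longrightarrow> R y = eval_fps F (y - 0)"
    using an unfolding real_analytic_on_def by blast
  obtain d where d: "d > 0" "\<And>y. 0 \<le> y \<Longrightarrow> y < d \<Longrightarrow> R y = eval_fps F y"
    using ev unfolding eventually_nhds_metric by (auto simp: dist_real_def)
  have near: "eventually (\<lambda>x. x \<in> {0<..<e}) (at_right (0::real))" if "e > 0" for e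
    using that by (rule eventually_at_right_real)
  have evR: "eventually (\<lambda>x. eval_fps F x / x ^ j = R x / x ^ j) (at_right 0)" for j
    using near[OF d(1)] by eventually_elim (simp add: d(2))
  have F0: "F \<noteq> 0"
  proof
    assume "F = 0"
    have "eventually (\<lambda>x. R x / x ^ m = 0) (at_right 0)"
      using near[OF d(1)] by eventually_elim (simp add: d(2) \<open>F = 0\<close>)
    then have "((\<lambda>x. R x / x ^ m) \<longlongrightarrow> 0) (at_right 0)"
      by (rule tendsto_eventually)
    from tendsto_unique[OF _ C(2) this] C(1) show False by simp
  qed
  have "((\<lambda>x. R x / x ^ subdegree F) \<longlongrightarrow> fps_nth F (subdegree F)) (at_right 0)"
    using tendsto_eval_fps_subdegree[OF rad] evR by (rule Lim_transform_eventually)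
  then have sub: "subdegree F = m"
    using power_order_unique[OF C(2,1)] F0 by simp
  obtain r where r: "0 < ereal r" "ereal r < fps_conv_radius F"
    using ereal_dense2[OF rad] by auto
  have "eventually (\<lambda>x. eval_fps (pantograph_defect a F) x = 0) (at_right 0)"
    \<comment> \<open>The halves keep \<open>2 * x\<close> as well as \<open>x\<close> where
      \<open>R\<close> agrees with the series and the series converges.\<close>
    using near[of "min (d/2) (r/2)"] d(1) r(1)
  proof (simp, elim eventually_mono)
    fix x :: real
    assume "0 < x \<and> x * 2 < d \<and> x * 2 < r"
    then have x: "0 < x" "2 * x < d" "2 * x < r" by auto
    obtain D where D: "(R has_real_derivative D) (at x within {0..})"
      "sin x * D = 4 * a * R (2 * x) - 3 * cos x * R x"
      by (rule mirror_pantographE[OF mp less_imp_le[OF x(1)]])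
    \<comment> \<open>At a positive point the derivative relative to \<open>{0..}\<close> is
      two-sided, so it can be identified with the termwise derivative of the series.\<close>
    have "(R has_real_derivative D) (at x)"
      using D(1) x(1) by (simp add: at_within_interior[of x "{0..}"])
    then have D': "(eval_fps F has_real_derivative D) (at x)"
      by (rule has_field_derivative_transform_within_open[where S = "{0<..<d}"]) (use x in \<open>auto simp: d(2)\<close>)
    have x2: "ereal (2 * \<bar>x\<bar>) < fps_conv_radius F"
      using x by (intro less_trans[OF _ r(2)]) simp
    then have "ereal (norm x) < fps_conv_radius F"
      by (rule le_less_trans[rotated]) simp
    then have "D = eval_fps (fps_deriv F) x"
      using D' by (metis DERIV_unique has_field_derivative_eval_fps)
    then show "eval_fps (pantograph_defect a F) x = 0"
      using D(2) x eval_pantograph_defect[OF x2, of a] d(2)[of x] d(2)[of "2 * x"] by simp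
  qed
  moreover have "fps_conv_radius (pantograph_defect a F) > 0"
  proof -
    have "fps_conv_radius (fps_double F) > 0"
      unfolding fps_conv_radius_double using rad by (cases "fps_conv_radius F") auto
    moreover have "fps_conv_radius (fps_deriv F) > 0"
      using rad fps_conv_radius_deriv[of F] by (rule less_le_trans)
    ultimately show ?thesis
      unfolding pantograph_defect_def using rad
      by (intro less_le_trans[OF _ fps_conv_radius_diff] less_le_trans[OF _ fps_conv_radius_add]
           less_le_trans[OF _ fps_conv_radius_mult] min_less_iff_conj[THEN iffD2] conjI) auto
  qed
  ultimately have "pantograph_defect a F = 0"
    by (intro fps_eq_0_if_zero_at_right)
  with F0 sub d r show thesis
    by (intro that[of F "min d r"]) (auto simp: min_le_iff_disj less_imp_le)
qed

section \<open>Uniqueness up to scale\<close>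

lemma mirror_pantograph_lincomb:
  assumes "mirror_pantograph a R" "mirror_pantograph a Q"
  shows "mirror_pantograph a (\<lambda>x. R x - c * Q x)"
  unfolding mirror_pantograph_def
proof (intro allI impI)
  fix x :: real
  assume "x \<ge> 0"
  then obtain D E where D: "(R has_real_derivative D) (at x within {0..})"
      "sin x * D = 4 * a * R (2 * x) - 3 * cos x * R x"
    and E: "(Q has_real_derivative E) (at x within {0..})"
      "sin x * E = 4 * a * Q (2 * x) - 3 * cos x * Q x"
    using assms by (meson mirror_pantographE)
  have "sin x * (D - c * E) = sin x * D - c * (sin x * E)"
    by (simp add: algebra_simps)
  then have "sin x * (D - c * E) = 4 * a * (R (2 * x) - c * Q (2 * x)) - 3 * cos x * (R x - c * Q x)"
    unfolding D(2) E(2) by (simp add: algebra_simps)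
  moreover have "((\<lambda>x. R x - c * Q x) has_real_derivative (D - c * E)) (at x within {0..})"
    using D(1) E(1) by (auto intro!: derivative_eq_intros)
  ultimately show "\<exists>D. ((\<lambda>x. R x - c * Q x) has_real_derivative D) (at x within {0..}) \<and>
      sin x * D = 4 * a * (R (2 * x) - c * Q (2 * x)) - 3 * cos x * (R x - c * Q x)"
    by blast
qed

text \<open>As \<open>a\<close> is nonzero, the equation determines \<open>R (2 * z)\<close> from
  the value and derivative of \<open>R\<close> at \<open>z\<close>. Vanishing on
  \<open>[0, 2 ^ n * d)\<close> thus passes to the interval of twice the length, and these intervals
  exhaust the half-line.\<close>

lemma mirror_pantograph_zero_extend:
  assumes mp: "mirror_pantograph a R" and a: "a \<noteq> 0" and d: "d > 0"
    and zero: "\<And>y. 0 \<le> y \<Longrightarrow> y < d \<Longrightarrow> R y = 0"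
    and "x \<ge> 0"
  shows "R x = 0"
proof -
  have ext: "R y = 0" if "0 \<le> y" "y < 2 ^ n * d" for n y
    using that
  proof (induction n arbitrary: y)
    case 0
    then show ?case using zero by simp
  next
    case (Suc n)
    show ?case
    \<comment> \<open>The point 0 is treated apart, since the argument needs a two-sided derivative
      at \<open>y / 2\<close>.\<close>
    proof (cases "y = 0")
      case True
      then show ?thesis using zero d by simp
    next
      case False
      define z where "z = y / 2"
      have z: "0 < z" "z < 2 ^ n * d" "y = 2 * z"
        using Suc.prems False by (auto simp: z_def)
      obtain D where D: "(R has_real_derivative D) (at z within {0..})"
        "sin z * D = 4 * a * R (2 * z) - 3 * cos z * R z"
        by (rule mirror_pantographE[OF mp less_imp_le[OF z(1)]])
      have "(R has_real_derivative D) (at z)"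
        using D(1) z(1) by (simp add: at_within_interior[of z "{0..}"])
      \<comment> \<open>By induction \<open>R\<close> vanishes on an open interval around
        \<open>z\<close>, so its derivative there is that of the zero function.\<close>
      then have "((\<lambda>_. 0) has_real_derivative D) (at z)"
        by (rule has_field_derivative_transform_within_open[where S = "{0<..<2 ^ n * d}"])
           (use z Suc.IH in auto)
      then have "D = 0"
        using DERIV_unique DERIV_const by blast
      then show ?thesis
        using D(2) Suc.IH[of z] z a by simp
    qed
  qed
  obtain n where "x / d < 2 ^ n"
    using real_arch_pow[of 2 "x / d"] by auto
  then show ?thesis
    using ext[of x n] \<open>x \<ge> 0\<close> d by (simp add: field_simps)
qed

text \<open>Subtracting a multiple of one germ from the other cancels the coefficient of order
  \<open>m\<close>. The difference still solves the equation, so it is 0 by the indicial equation,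
  and doubling carries this to the half-line.\<close>

lemma global_solutions_proportional:
  assumes "global_solution a m R1" "global_solution a m R2"
  shows "\<exists>c. c \<noteq> 0 \<and> (\<forall>x\<ge>0. R2 x = c * R1 x)"
proof -
  obtain F d where F: "F \<noteq> 0" "subdegree F = m" "pantograph_defect a F = 0"
    "d > 0" "ereal d \<le> fps_conv_radius F" "\<And>y. 0 \<le> y \<Longrightarrow> y < d \<Longrightarrow> R1 y = eval_fps F y"
    using global_solution_germ[OF assms(1)] by blast
  obtain G e where G: "G \<noteq> 0" "subdegree G = m" "pantograph_defect a G = 0"
    "e > 0" "ereal e \<le> fps_conv_radius G" "\<And>y. 0 \<le> y \<Longrightarrow> y < e \<Longrightarrow> R2 y = eval_fps G y"
    using global_solution_germ[OF assms(2)] by blast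
  have ind: "4 * a * 2 ^ m = real m + 3"
    using pantograph_indicial_equation[OF F(3,1)] F(2) by simp
  have nz: "fps_nth F m \<noteq> 0" "fps_nth G m \<noteq> 0"
    using F(1,2) G(1,2) nth_subdegree_nonzero[of F] nth_subdegree_nonzero[of G] by simp_all
  define c where "c = fps_nth G m / fps_nth F m"
  define H where "H = G - fps_const c * F"
  have "pantograph_defect a H = 0"
    unfolding H_def by (simp add: pantograph_defect_lincomb F(3) G(3))
  have "H = 0"
  proof (rule ccontr)
    assume "H \<noteq> 0"
    have "fps_nth H j = 0" if "j < m" for j
      unfolding H_def using that F(2) G(2) nth_less_subdegree_zero[of j F] nth_less_subdegree_zero[of j G]
      by simp
    moreover have "fps_nth H m = 0"
      using nz by (simp add: H_def c_def)
    ultimately have "fps_nth H j = 0" if "j \<le> m" for j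
      using that by (cases "j = m") auto
    then have "m < subdegree H"
      using \<open>H \<noteq> 0\<close> by (metis leI nth_subdegree_nonzero)
    \<comment> \<open>A nonzero \<open>H\<close> would give a second indicial exponent, larger than
      \<open>m\<close>.\<close>
    from pantograph_factor_gt[OF ind this]
      pantograph_indicial_equation[OF \<open>pantograph_defect a H = 0\<close> \<open>H \<noteq> 0\<close>]
    show False by simp
  qed
  then have GF: "G = fps_const c * F" by (simp add: H_def)
  have c: "c \<noteq> 0" using nz by (simp add: c_def)
  have ev: "eval_fps G y = c * eval_fps F y" if "0 \<le> y" "y < d" for y
  proof -
    have "ereal (norm y) < fps_conv_radius F"
      by (rule less_le_trans[OF _ F(5)]) (use that in simp)
    then show ?thesis
      unfolding GF by (subst eval_fps_mult) simp_all
  qed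
  have "mirror_pantograph a (\<lambda>x. R2 x - c * R1 x)"
    using assms by (intro mirror_pantograph_lincomb) (auto simp: global_solution_def)
  moreover have "a \<noteq> 0"
    using ind by auto
  moreover have "min d e > 0"
    using F(4) G(4) by simp
  moreover have "R2 y - c * R1 y = 0" if "0 \<le> y" "y < min d e" for y
    using that F(6)[of y] G(6)[of y] ev[of y] by simp
  ultimately have "R2 x - c * R1 x = 0" if "x \<ge> 0" for x
    using that by (rule mirror_pantograph_zero_extend)
  with c show ?thesis by auto
qed

section \<open>Real-analyticity of everywhere convergent power series\<close>

lemma real_analytic_on_eval_fps:
  fixes F :: "real fps"
  assumes "fps_conv_radius F = \<infinity>"
  shows "real_analytic_on (eval_fps F) S"
  unfolding real_analytic_on_def
proof
  fix x :: real
  \<comment> \<open>Expand the complex extension at \<open>x\<close> and take real parts of the coefficients.\<close>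
  define E where "E = Abs_fps (\<lambda>n. complex_of_real (fps_nth F n))"
  have "fps_conv_radius E = conv_radius (\<lambda>n. norm (fps_nth E n))"
    by (simp add: fps_conv_radius_def)
  also have "\<dots> = conv_radius (\<lambda>n. norm (fps_nth F n))"
    by (simp only: E_def fps_nth_Abs_fps norm_of_real real_norm_def)
  also have "\<dots> = \<infinity>"
    using assms by (simp only: conv_radius_norm fps_conv_radius_def)
  finally have rE: "fps_conv_radius E = \<infinity>" .
  have evE: "eval_fps E (of_real y) = of_real (eval_fps F y)" for y
  proof -
    have "summable (\<lambda>n. fps_nth F n * y ^ n)"
      using assms by (intro summable_fps) simp
    then show ?thesis
      by (simp add: eval_fps_def E_def suminf_of_real)
  qed
  have "eval_fps E analytic_on {of_real x}"
    by (rule analytic_on_eval_fps) (auto simp: rE)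
  then obtain G where G: "(\<lambda>z. eval_fps E (of_real x + z)) has_fps_expansion G"
    using analytic_at_imp_has_fps_expansion by blast
  define H where "H = Abs_fps (\<lambda>n. Re (fps_nth G n))"
  \<comment> \<open>Real parts are bounded by moduli, so the radius does not shrink.\<close>
  have le: "fps_conv_radius G \<le> fps_conv_radius H"
    unfolding fps_conv_radius_def
  proof (rule conv_radius_geI_ex')
    fix r :: real
    assume "0 < r" "ereal r < conv_radius (fps_nth G)"
    then have "summable (\<lambda>n. norm (fps_nth G n * of_real r ^ n))"
      by (intro abs_summable_in_conv_radius) simp
    then show "summable (\<lambda>n. fps_nth H n * of_real r ^ n)"
      by (rule summable_comparison_test')
         (auto simp: H_def norm_mult abs_mult norm_power power_abs abs_Re_le_cmod intro!: mult_right_mono)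
  qed
  have rG: "fps_conv_radius G > 0"
    using G by (simp add: has_fps_expansion_def)
  \<comment> \<open>Powers of a real increment are real, so the real part can be taken
    termwise.\<close>
  have evH: "eval_fps H y = Re (eval_fps G (of_real y))"
    if "ereal (norm y) < fps_conv_radius G" for y
  proof -
    have "(\<lambda>n. fps_nth G n * of_real y ^ n) sums eval_fps G (of_real y)"
      using that by (intro sums_eval_fps) simp
    from sums_Re[OF this] show ?thesis
      by (simp add: H_def eval_fps_def sums_iff flip: of_real_power)
  qed
  obtain r where r: "0 < ereal r" "ereal r < fps_conv_radius G"
    using ereal_dense2[OF rG] by auto
  obtain e where e: "e > 0" "\<And>z. norm z < e \<Longrightarrow> eval_fps G z = eval_fps E (of_real x + z)"
    using G unfolding has_fps_expansion_def eventually_nhds_metric by (auto simp: dist_norm)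
  have "eval_fps F y = eval_fps H (y - x)" if "dist y x < min r e" for y
  proof -
    have "ereal (norm (y - x)) < fps_conv_radius G"
      using that by (intro less_trans[OF _ r(2)]) (simp add: dist_real_def)
    then have "eval_fps H (y - x) = Re (eval_fps G (of_real (y - x)))"
      by (rule evH)
    also have "\<dots> = Re (eval_fps E (of_real y))"
      using e(2)[of "of_real (y - x)"] that by (simp add: dist_real_def norm_of_real del: of_real_diff) simp
    finally show ?thesis by (simp add: evE)
  qed
  then have "\<forall>\<^sub>F y in nhds x. y \<in> S \<longrightarrow> eval_fps F y = eval_fps H (y - x)"
    using r(1) e(1) unfolding eventually_nhds_metric by (intro exI[of _ "min r e"]) auto
  with rG le show "\<exists>F'. fps_conv_radius F' > 0 \<and>
      (\<forall>\<^sub>F y in nhds x. y \<in> S \<longrightarrow> eval_fps F y = eval_fps F' (y - x))"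
    by (intro exI[of _ H]) auto
qed

section \<open>The coefficient recursion and existence\<close>

text \<open>The equation at order \<open>n\<close> solved for coefficient \<open>n\<close>. The
  value 1 at \<open>m\<close> is a normalisation: there the factor vanishes for the right
  \<open>a\<close>, which leaves the coefficient free.\<close>

fun pantograph_coeff :: "real \<Rightarrow> nat \<Rightarrow> nat \<Rightarrow> real" where
  "pantograph_coeff a m n =
     (if n < m then 0 else if n = m then 1 else
       ((\<Sum>i=2..n. fps_nth (fps_sin 1) i * (real (n + 1 - i) * pantograph_coeff a m (n + 1 - i)))
        + 3 * (\<Sum>i=1..n. fps_nth (fps_cos 1) i * pantograph_coeff a m (n - i)))
       / (4 * a * 2 ^ n - real n - 3))"

declare pantograph_coeff.simps [simp del]

lemma pantograph_coeff_rec: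
  assumes "m < n"
  shows "pantograph_coeff a m n =
       ((\<Sum>i=2..n. fps_nth (fps_sin 1) i * (real (n + 1 - i) * pantograph_coeff a m (n + 1 - i)))
        + 3 * (\<Sum>i=1..n. fps_nth (fps_cos 1) i * pantograph_coeff a m (n - i)))
       / (4 * a * 2 ^ n - real n - 3)"
proof -
  have "\<not> n < m" "n \<noteq> m"
    using assms by auto
  then show ?thesis
    by (subst pantograph_coeff.simps) (simp only: if_False)
qed

text \<open>Below \<open>m\<close> all coefficients involved vanish, at \<open>m\<close> the factor
  does, and above \<open>m\<close> the recursion applies because its divisor is positive.\<close>

lemma pantograph_defect_coeff:
  assumes "4 * a * 2 ^ m = real m + 3"
  shows "pantograph_defect a (Abs_fps (pantograph_coeff a m)) = 0"
proof (rule fps_ext)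
  fix n
  have z: "pantograph_coeff a m j = 0" if "j < m" for j
    using that by (subst pantograph_coeff.simps) simp
  show "fps_nth (pantograph_defect a (Abs_fps (pantograph_coeff a m))) n = fps_nth 0 n"
  proof (cases "m < n")
    case True
    then have "4 * a * 2 ^ n - real n - 3 \<noteq> 0"
      using pantograph_factor_gt[OF assms True] by simp
    with pantograph_coeff_rec[OF True, of a] show ?thesis
      unfolding pantograph_defect_nth by (simp add: field_simps)
  next
    case False
    then have "(real n + 3 - 4 * a * 2 ^ n) * pantograph_coeff a m n = 0"
      using assms z by (cases "n = m") auto
    moreover have "fps_nth (pantograph_defect a (Abs_fps (pantograph_coeff a m))) n
        = (real n + 3 - 4 * a * 2 ^ n) * fps_nth (Abs_fps (pantograph_coeff a m)) n"
      by (rule pantograph_defect_nth_leading) (use False z in simp)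
    ultimately show ?thesis by simp
  qed
qed

lemma abs_fps_sin_cos_nth_le:
  "\<bar>fps_nth (fps_sin (1::real)) i\<bar> \<le> 1" "\<bar>fps_nth (fps_cos (1::real)) i\<bar> \<le> 1"
  by (auto simp: fps_sin_def fps_cos_def abs_divide power_abs fact_ge_1 divide_le_eq_1)

text \<open>If the earlier coefficients are bounded by \<open>B\<close>, the numerator is at most
  \<open>n * (n + 3) * B\<close>. The divisor eventually exceeds \<open>n * (n + 3)\<close>, so a
  bound for an initial segment persists.\<close>

lemma pantograph_coeff_bounded:
  assumes "4 * a * 2 ^ m = real m + 3"
  shows "\<exists>B. \<forall>n. \<bar>pantograph_coeff a m n\<bar> \<le> B"
proof -
  have "0 < 4 * a * 2 ^ m"
    unfolding assms by simp
  then have a: "a > 0"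
    by (simp add: zero_less_mult_iff)
  have "eventually (\<lambda>n. real n * (real n + 3) \<le> 4 * a * 2 ^ n - real n - 3) sequentially"
    using a by real_asymp
  then obtain N where N: "\<And>n. n \<ge> N \<Longrightarrow> real n * (real n + 3) \<le> 4 * a * 2 ^ n - real n - 3"
    unfolding eventually_sequentially by blast
  \<comment> \<open>The sum dominates every coefficient up to \<open>max N m\<close>; beyond this
    index both the recursion and the estimate of the divisor are available.\<close>
  define B where "B = (\<Sum>j\<le>max N m. \<bar>pantograph_coeff a m j\<bar>)"
  have B0: "B \<ge> 0"
    by (simp add: B_def sum_nonneg)
  have "\<bar>pantograph_coeff a m n\<bar> \<le> B" for n
  proof (induction n rule: less_induct)
    case (less n)
    show ?case
    proof (cases "n \<le> max N m")
      case True
      then show ?thesis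
        unfolding B_def by (intro member_le_sum) auto
    next
      case False
      then have n: "m < n" "N \<le> n" by auto
      define q where "q = 4 * a * 2 ^ n - real n - 3"
      have q: "q > 0" "real n * (real n + 3) \<le> q"
        using pantograph_factor_gt[OF assms n(1)] N[OF n(2)] by (auto simp: q_def)
      \<comment> \<open>There are at most \<open>n\<close> summands; in each the sine coefficient is
        at most 1 in modulus and the derivative factor \<open>n + 1 - i\<close> at most
        \<open>n\<close>.\<close>
      have "\<bar>\<Sum>i=2..n. fps_nth (fps_sin 1) i * (real (n + 1 - i) * pantograph_coeff a m (n + 1 - i))\<bar>
          \<le> (\<Sum>i=2..n. 1 * (real n * B))"
      proof (rule order_trans[OF sum_abs], rule sum_mono)
        fix i assume "i \<in> {2..n}"
        then show "\<bar>fps_nth (fps_sin 1) i * (real (n + 1 - i) * pantograph_coeff a m (n + 1 - i))\<bar>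
          \<le> 1 * (real n * B)"
          unfolding abs_mult
          by (intro mult_mono less.IH abs_fps_sin_cos_nth_le) (auto simp: B0)
      qed
      also have "\<dots> \<le> real n * (real n * B)"
        using B0 by (auto intro!: mult_right_mono)
      finally have 1: "\<bar>\<Sum>i=2..n. fps_nth (fps_sin 1) i * (real (n + 1 - i) * pantograph_coeff a m (n + 1 - i))\<bar>
          \<le> real n * (real n * B)" .
      have "\<bar>\<Sum>i=1..n. fps_nth (fps_cos 1) i * pantograph_coeff a m (n - i)\<bar> \<le> (\<Sum>i=1..n. 1 * B)"
      proof (rule order_trans[OF sum_abs], rule sum_mono)
        fix i assume "i \<in> {1..n}"
        then show "\<bar>fps_nth (fps_cos 1) i * pantograph_coeff a m (n - i)\<bar> \<le> 1 * B"
          unfolding abs_mult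
          by (intro mult_mono less.IH abs_fps_sin_cos_nth_le) (auto simp: B0)
      qed
      then have 2: "\<bar>\<Sum>i=1..n. fps_nth (fps_cos 1) i * pantograph_coeff a m (n - i)\<bar> \<le> real n * B"
        by simp
      have "\<bar>(\<Sum>i=2..n. fps_nth (fps_sin 1) i * (real (n + 1 - i) * pantograph_coeff a m (n + 1 - i)))
        + 3 * (\<Sum>i=1..n. fps_nth (fps_cos 1) i * pantograph_coeff a m (n - i))\<bar>
        \<le> real n * (real n * B) + 3 * (real n * B)"
        using 1 2 by linarith
      also have "\<dots> = real n * (real n + 3) * B"
        by (simp add: algebra_simps)
      also have "\<dots> \<le> q * B"
        using q(2) B0 by (rule mult_right_mono)
      finally show ?thesis
        unfolding pantograph_coeff_rec[OF n(1)] q_def[symmetric] abs_divide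
        using q(1) by (simp add: divide_le_eq mult.commute)
    qed
  qed
  then show ?thesis by blast
qed

lemma pantograph_defect_imp_entire:
  assumes "pantograph_defect a F = 0" "a \<noteq> 0" "fps_conv_radius F > 0"
  shows "fps_conv_radius F = \<infinity>"
proof -
  have "fps_const (4 * a) * fps_double F = fps_sin 1 * fps_deriv F + 3 * (fps_cos 1 * F)"
    using assms(1) by (simp add: pantograph_defect_def)
  moreover have "fps_conv_radius F \<le> fps_conv_radius (fps_sin 1 * fps_deriv F + 3 * (fps_cos 1 * F))"
    by (intro order_trans[OF _ fps_conv_radius_add] order_trans[OF _ fps_conv_radius_mult] min.boundedI)
       (auto simp: fps_conv_radius_deriv)
  ultimately have "fps_conv_radius F \<le> fps_conv_radius (fps_const (4 * a) * fps_double F)"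
    by simp
  also have "\<dots> = fps_conv_radius F / 2"
    using assms(2) by (simp add: fps_conv_radius_cmult_left fps_conv_radius_double)
  \<comment> \<open>No positive finite radius is at most its own half.\<close>
  finally show ?thesis
    using assms(3) by (cases "fps_conv_radius F") auto
qed

lemma global_solution_exists:
  assumes "4 * a * 2 ^ m = real m + 3"
  shows "\<exists>R. global_solution a m R"
proof -
  define F where "F = Abs_fps (pantograph_coeff a m)"
  have eq: "pantograph_defect a F = 0"
    unfolding F_def by (rule pantograph_defect_coeff[OF assms])
  obtain B where B: "\<And>n. \<bar>pantograph_coeff a m n\<bar> \<le> B"
    using pantograph_coeff_bounded[OF assms] by blast
  \<comment> \<open>Bounded coefficients give convergence at any point of \<open>(0, 1)\<close>.
    Only positivity of the radius matters, since the equation then makes it infinite.\<close>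
  have "ereal (norm (1 / 2 :: real)) \<le> fps_conv_radius F"
    unfolding fps_conv_radius_def
  proof (rule conv_radius_geI)
    have "summable (\<lambda>n. B * (1 / 2) ^ n)"
      by (intro summable_mult summable_geometric) simp
    then show "summable (\<lambda>n. fps_nth F n * (1 / 2) ^ n)"
      by (rule summable_comparison_test') 
         (auto simp: F_def abs_mult power_abs B abs_divide intro!: divide_right_mono)
  qed
  then have "fps_conv_radius F > 0"
    by (rule less_le_trans[rotated]) simp
  moreover have "a \<noteq> 0"
    using assms by auto
  ultimately have rad: "fps_conv_radius F = \<infinity>"
    using eq by (intro pantograph_defect_imp_entire)
  have coeff: "fps_nth F n = (if n = m then 1 else 0)" if "n \<le> m" for n
    using that pantograph_coeff.simps[of a m n] unfolding F_def fps_nth_Abs_fps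
    by (cases "n = m") simp_all
  then have sub: "subdegree F = m"
    by (intro subdegreeI) auto
  have "mirror_pantograph a (eval_fps F)"
    unfolding mirror_pantograph_def
  proof (intro allI impI exI conjI)
    fix x :: real
    show "(eval_fps F has_real_derivative eval_fps (fps_deriv F) x) (at x within {0..})"
      by (rule has_field_derivative_eval_fps) (simp add: rad)
    show "sin x * eval_fps (fps_deriv F) x = 4 * a * eval_fps F (2 * x) - 3 * cos x * eval_fps F x"
      using eval_pantograph_defect[of x F a] by (simp add: rad eq)
  qed
  moreover have "behaves_like_power m (eval_fps F)"
    using tendsto_eval_fps_subdegree[of F] coeff[of m]
    unfolding behaves_like_power_def by (intro exI[of _ 1]) (simp add: rad sub)
  ultimately show ?thesis
    using real_analytic_on_eval_fps[OF rad] unfolding global_solution_def by blast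
qed

theorem theorem2:
  fixes a :: real and m :: nat
  shows "((\<exists>R. global_solution a m R) \<longleftrightarrow> a = (real m + 3) / 2 ^ (m + 2)) \<and>
    (\<forall>R\<^sub>1 R\<^sub>2. global_solution a m R\<^sub>1 \<and> global_solution a m R\<^sub>2 \<longrightarrow>
       (\<exists>c. c \<noteq> 0 \<and> (\<forall>\<theta>\<ge>0. R\<^sub>2 \<theta> = c * R\<^sub>1 \<theta>)))"
proof -
  have "4 * a * 2 ^ m = real m + 3" if "global_solution a m R" for R
    using global_solution_germ[OF that] pantograph_indicial_equation by metis
  \<comment> \<open>As \<open>2 ^ (m + 2) = 4 * 2 ^ m\<close>, the closed form for \<open>a\<close>
    is the indicial equation with exponent \<open>m\<close>.\<close>
  moreover have "a = (real m + 3) / 2 ^ (m + 2) \<longleftrightarrow> 4 * a * 2 ^ m = real m + 3"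
    by (simp add: field_simps)
  ultimately show ?thesis
    using global_solution_exists global_solutions_proportional by blast
qed

end
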